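(* Let $n\ge 1$, and let $-\infty\le p\le\infty$ with $p\neq 0$ if $n=1$, and $1\le p\le\infty$ if $n\ge 2$. If $p\ne 1$, then the operation $+_p:(\mathcal{K}^n_s)^2\to\mathcal{K}^n_s$ does not have polynomial volume.
   Context: $\mathcal{K}^n_s$ is the class of nonempty compact convex subsets $K$ of $\mathbb{R}^n$ with $K=-K$. $h_K(x)=\sup\{x\cdot y:y\in K\}$ is the support function; $\mathcal{H}^n$ is $n$-dimensional Hausdorff measure (volume). $L_p$ addition for $1\le p<\infty$: $K+_pL$ is the compact convex set with $h_{K+_pL}(x)^p=h_K(x)^p+h_L(x)^p$ for all $x\in\mathbb{R}^n$; for $p=\infty$, $h_{K+_\infty L}=\max\{h_K,h_L\}$. When $n=1$, $+_p$ is defined for all $-\infty\le p\le\infty$, $p\ne0$, by $[-s,s]+_p[-t,t]=[-f(s,t),f(s,t)]$ for $s,t\ge 0$, where $f(s,t)=(s^p+t^p)^{1/p}$ if $0<p<\infty$; $f(s,t)=\max\{s,t\}$ if $p=\infty$; $f(s,t)=(s^p+t^p)^{1/p}$ if $-\infty<p<0$ and $s,t>0$, and $f(s,t)=0$ if $-\infty<p<0$ and $s=0$ or $t=0$; $f(s,t)=\min\{s,t\}$ if $p=-\infty$. An operation $*:(\mathcal{K}^n_s)^2\to\mathcal{K}^n_s$ has polynomial volume if for all $K,L\in\mathcal{K}^n_s$ there are $m(K,L)\in\mathbb{N}\cup\{0\}$ and real coefficients $a_{ij}(K,L)$ such that $\mathcal{H}^n((rK)*(sL))=\sum_{i,j=0}^{m(K,L)}a_{ij}(K,L)r^is^j$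 for all $r,s\ge 0$. *)

theory Defs
  imports "HOL-Analysis.Analysis"
begin

definition sym_convex_bodies :: "(real ^ 'n) set set" where
  "sym_convex_bodies = {K. K \<noteq> {} \<and> compact K \<and> convex K \<and> K = uminus ` K}"

definition support_fun :: "(real ^ 'n) set \<Rightarrow> real ^ 'n \<Rightarrow> real" where
  "support_fun K x = (SUP y\<in>K. x \<bullet> y)"

text \<open>The defining relation of the \<open>L\<^sub>p\<close> sum for \<open>1 \<le> p \<le> \<infinity>\<close>. It is only used for sets
  containing the origin, whose support functions are nonnegative, so that \<open>powr\<close> is the
  usual power (with \<open>0 powr q = 0\<close>).\<close>

definition is_Lp_sum ::
  "ereal \<Rightarrow> (real ^ 'n) set \<Rightarrow> (real ^ 'n) set \<Rightarrow> (real ^ 'n) set \<Rightarrow> bool" where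
  "is_Lp_sum p K L M \<longleftrightarrow> M \<noteq> {} \<and> compact M \<and> convex M \<and>
    (if p = \<infinity> then \<forall>x. support_fun M x = max (support_fun K x) (support_fun L x)
     else \<forall>x. support_fun M x powr real_of_ereal p =
            support_fun K x powr real_of_ereal p + support_fun L x powr real_of_ereal p)"

text \<open>The function \<open>f(s, t)\<close> for \<open>s, t \<ge> 0\<close>; the value at \<open>p = 0\<close> is irrelevant.\<close>

definition Lp_radius :: "ereal \<Rightarrow> real \<Rightarrow> real \<Rightarrow> real" where
  "Lp_radius p s t = (case p of
      PInfty \<Rightarrow> max s t
    | MInfty \<Rightarrow> min s t
    | ereal q \<Rightarrow>
        if q > 0 \<or> (s > 0 \<and> t > 0) then (s powr q + t powr q) powr (1 / q) else 0)"

text \<open>The interval \<open>[-s, s]\<close>, when the dimension \<open>CARD('n)\<close> is 1.\<close>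

definition sym_interval :: "real \<Rightarrow> (real ^ 'n) set" where
  "sym_interval s = cbox (vec (- s)) (vec s)"

text \<open>In dimension 1 the interval definition is used for every \<open>p \<noteq> 0\<close>; for \<open>p \<ge> 1\<close> it
  agrees with the one by support functions. In higher dimensions the definition is meaningful
  only for \<open>p \<ge> 1\<close>. In both cases the description determines the sum uniquely for arguments
  in \<^const>\<open>sym_convex_bodies\<close>.\<close>

definition Lp_add ::
  "ereal \<Rightarrow> (real ^ 'n) set \<Rightarrow> (real ^ 'n) set \<Rightarrow> (real ^ 'n) set" where
  "Lp_add p K L =
    (if CARD('n) = 1
     then THE M. \<exists>s\<ge>0. \<exists>t\<ge>0. K = sym_interval s \<and> L = sym_interval t \<and>
                   M = sym_interval (Lp_radius p s t)
     else THE M. is_Lp_sum p K L M)"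

text \<open>Volume is \<open>n\<close>-dimensional Lebesgue measure, which on \<open>\<real>\<^sup>n\<close> coincides with
  \<open>n\<close>-dimensional Hausdorff measure in its usual normalization.\<close>

definition has_polynomial_volume ::
  "((real ^ 'n) set \<Rightarrow> (real ^ 'n) set \<Rightarrow> (real ^ 'n) set) \<Rightarrow> bool" where
  "has_polynomial_volume oper \<longleftrightarrow>
    (\<forall>K\<in>sym_convex_bodies. \<forall>L\<in>sym_convex_bodies. \<exists>(m::nat) (a :: nat \<Rightarrow> nat \<Rightarrow> real).
       \<forall>r\<ge>0. \<forall>s\<ge>0. measure lebesgue (oper ((*\<^sub>R) r ` K) ((*\<^sub>R) s ` L)) =
         (\<Sum>i\<le>m. \<Sum>j\<le>m. a i j * r ^ i * s ^ j))"

end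

theory Submission
  imports Defs "HOL-Computational_Algebra.Polynomial"
begin

text \<open>Let \<open>K\<close> be the segment \<open>[-e\<^sub>i, e\<^sub>i]\<close> and \<open>L\<close> the body whose support function is the
  \<open>l\<^sub>p\<close> norm. The support function of \<open>rK +\<^sub>p L\<close> is the \<open>l\<^sub>p\<close> norm with the \<open>i\<close>-th coordinate
  rescaled by \<open>f(r, 1)\<close>, so \<open>rK +\<^sub>p L\<close> is \<open>L\<close> stretched by \<open>f(r, 1)\<close> along \<open>e\<^sub>i\<close>, and polynomial
  volume would make \<open>f(r, 1)\<close> a polynomial in \<open>r\<close>. As \<open>f\<close> is symmetric and homogeneous of
  degree one, that polynomial has the form \<open>\<alpha>(1 + r)\<close>, whence \<open>f(1, 1) = 2 f(0, 1)\<close>, which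
  fails unless \<open>p = 1\<close>. In dimension one the interval \<open>[-1, 1]\<close> plays both roles.\<close>

section \<open>Support functions and uniqueness of L_p sums\<close>

lemma support_fun_bdd_above:
  assumes "compact K" shows "bdd_above ((\<lambda>y. x \<bullet> y) ` K)"
  by (intro bounded_imp_bdd_above compact_imp_bounded compact_continuous_image assms continuous_intros)

lemma inner_le_support_fun:
  assumes "compact K" "y \<in> K" shows "x \<bullet> y \<le> support_fun K x"
  unfolding support_fun_def by (intro cSUP_upper assms support_fun_bdd_above)

lemma support_fun_le:
  assumes "K \<noteq> {}" "\<And>y. y \<in> K \<Longrightarrow> x \<bullet> y \<le> c" shows "support_fun K x \<le> c"
  unfolding support_fun_def using assms by (intro cSUP_least)

text \<open>A point of \<open>K\<close> outside \<open>L\<close> would be strictly separated from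
  \<open>L\<close> by some \<open>a\<close>, making \<open>support_fun K\<close> exceed
  \<open>support_fun L\<close> at \<open>- a\<close>.\<close>

lemma support_fun_le_imp_subset:
  assumes "compact L" "convex L" "compact K" "L \<noteq> {}" "\<And>x. support_fun K x \<le> support_fun L x"
  shows "K \<subseteq> L"
proof
  fix z assume z: "z \<in> K"
  show "z \<in> L"
  proof (rule ccontr)
    assume "z \<notin> L"
    then obtain a b where ab: "a \<bullet> z < b" "\<And>x. x \<in> L \<Longrightarrow> a \<bullet> x > b"
      using separating_hyperplane_closed_point assms compact_imp_closed by metis
    have "support_fun L (- a) \<le> - b"
      using ab(2) assms(4) by (intro support_fun_le) (auto intro: less_imp_le)
    moreover have "(- a) \<bullet> z \<le> support_fun K (- a)"
      using inner_le_support_fun assms z by blast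
    ultimately show False using ab(1) assms(5)[of "- a"] by simp
  qed
qed

lemma support_fun_inject:
  assumes "compact L" "convex L" "L \<noteq> {}" "compact K" "convex K" "K \<noteq> {}"
    and "\<And>x. support_fun K x = support_fun L x"
  shows "K = L"
  using assms by (intro equalityI support_fun_le_imp_subset) auto

text \<open>Since \<open>ln (- x) = ln x\<close>, \<open>powr\<close> only sees the absolute value of its base, so the
  defining relation of the sum controls the support function of the sum up to sign only.\<close>

lemma support_fun_nonneg_if_abs:
  fixes M :: "(real ^ 'n) set"
  assumes n: "CARD('n) \<ge> 2" and M: "compact M" "convex M" "M \<noteq> {}"
    and H: "\<And>x. \<bar>support_fun M x\<bar> = H x" "\<And>x. x \<noteq> 0 \<Longrightarrow> H x > 0"
      "\<And>x. H (- x) = H x"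
  shows "support_fun M x \<ge> 0"
proof -
  have "0 \<in> M"
  proof (rule ccontr)
    assume "0 \<notin> M"
    then obtain a b where ab: "a \<in> M" "a \<noteq> 0" "0 < b" "\<And>x. x \<in> M \<Longrightarrow> a \<bullet> x > b"
      using separating_hyperplane_closed_0_inset M compact_imp_closed by metis
    have neg: "support_fun M (- a) \<le> - b"
      using ab(4) M(3) by (intro support_fun_le) (auto intro: less_imp_le)
    \<comment> \<open>The two values have opposite signs and equal absolute values, so
      \<open>M\<close> has width zero in direction \<open>a\<close> and lies in a
      hyperplane.\<close>
    have "support_fun M a = - support_fun M (- a)"
      using H(1)[of a] H(1)[of "-a"] H(3)[of a] neg ab(3) inner_le_support_fun[OF M(1) ab(1), of a]
        ab(4)[OF ab(1)] by linarith
    moreover have "(- a) \<bullet> y \<le> support_fun M (- a)" "a \<bullet> y \<le> support_fun M a" if "y \<in> M" for y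
      using inner_le_support_fun[OF M(1) that] by blast+
    ultimately have const: "a \<bullet> y = support_fun M a" if "y \<in> M" for y
      using that by fastforce
    define c where "c = a \<bullet> a"
    have c: "c > 0" using ab(2) by (simp add: c_def)
    have ac: "a \<bullet> y = c" if "y \<in> M" for y using const[OF that] const[OF ab(1)] by (simp add: c_def)
    \<comment> \<open>The second dimension enters here: on the line, any one-point set other than
      {0} satisfies the remaining hypotheses, yet its support function takes negative
      values.\<close>
    obtain w where w: "w \<noteq> 0" "orthogonal a w"
      using orthogonal_to_vector_exists[of a] n by (auto simp: DIM_cart)
    \<comment> \<open>Since \<open>a\<close> is constantly \<open>c\<close> on \<open>M\<close>,
      subtracting \<open>t *\<^sub>R a\<close> from \<open>w\<close> lowers the support function by
      \<open>t * c\<close>; this \<open>t\<close> makes it vanish at \<open>u\<close>, against the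
      positivity of \<open>H\<close>.\<close>
    define t where "t = support_fun M w / c"
    define u where "u = w - t *\<^sub>R a"
    have "u \<bullet> w = w \<bullet> w" using w(2) by (simp add: u_def inner_diff_left orthogonal_def)
    then have u0: "u \<noteq> 0" using w(1) by auto
    have "support_fun M u \<le> 0"
    proof (rule support_fun_le[OF M(3)])
      fix y assume y: "y \<in> M"
      then have "u \<bullet> y = w \<bullet> y - support_fun M w"
        using ac[OF y] c by (simp add: u_def inner_diff_left t_def)
      then show "u \<bullet> y \<le> 0" using inner_le_support_fun[OF M(1) y, of w] by simp
    qed
    moreover have "support_fun M u \<ge> 0"
    proof -
      have "support_fun M w \<le> support_fun M u + t * c"
      proof (rule support_fun_le[OF M(3)])
        fix y assume y: "y \<in> M"
        have "w \<bullet> y = u \<bullet> y + t * c" using ac[OF y] by (simp add: u_def inner_diff_left)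
        then show "w \<bullet> y \<le> support_fun M u + t * c"
          using inner_le_support_fun[OF M(1) y, of u] by simp
      qed
      then show ?thesis using c by (simp add: t_def)
    qed
    ultimately show False using H(1)[of u] H(2)[OF u0] by simp
  qed
  then show ?thesis using inner_le_support_fun[OF M(1), of 0 x] by simp
qed

text \<open>The signs are left free because this is applied to the support function of a rival sum,
  about whose sign nothing is known yet.\<close>

lemma powr_abs_inject:
  fixes x y q :: real
  assumes "x powr q = y powr q" "q \<noteq> 0" shows "\<bar>x\<bar> = \<bar>y\<bar>"
proof -
  have "\<bar>x\<bar> powr q = \<bar>y\<bar> powr q"
    using assms(1) by (auto simp: powr_def abs_if ln_minus split: if_splits)
  then have "(\<bar>x\<bar> powr q) powr (1 / q) = (\<bar>y\<bar> powr q) powr (1 / q)" by simp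
  then show ?thesis using assms(2) by (simp add: powr_powr)
qed

text \<open>The definite description needs uniqueness. For p = infinity the relation fixes the
  support function; for finite p it does so up to sign, and positivity and evenness of
  \<open>support_fun M\<close> make \<open>support_fun_nonneg_if_abs\<close> applicable to any
  rival.\<close>

lemma Lp_add_eqI:
  fixes M :: "(real ^ 'n) set"
  assumes n: "CARD('n) \<ge> 2" and p: "p \<ge> 1" and M: "is_Lp_sum p K L M"
    and pos: "\<And>x. x \<noteq> 0 \<Longrightarrow> support_fun M x > 0"
    and even: "\<And>x. support_fun M (- x) = support_fun M x"
  shows "Lp_add p K L = M"
proof -
  have "M' = M" if M': "is_Lp_sum p K L M'" for M'
  proof -
    have body: "M \<noteq> {}" "compact M" "convex M" "M' \<noteq> {}" "compact M'" "convex M'"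
      using M M' by (auto simp: is_Lp_sum_def)
    have 0: "support_fun M 0 = 0" "support_fun M' 0 = 0"
      using body by (auto simp: support_fun_def)
    have ge: "support_fun M x \<ge> 0" for x using pos[of x] 0 by (cases "x = 0") auto
    have "support_fun M' x = support_fun M x" for x
    proof (cases "p = \<infinity>")
      case True
      then show ?thesis using M M' by (auto simp: is_Lp_sum_def)
    next
      case False
      then obtain q where q: "p = ereal q" "q \<ge> 1"
        using p by (cases p) auto
      have *: "\<bar>support_fun M' x\<bar> = support_fun M x" for x
        using powr_abs_inject[of "support_fun M' x" q "support_fun M x"] M M' q ge[of x]
        by (auto simp: is_Lp_sum_def)
      then have "support_fun M' x \<ge> 0"
        using support_fun_nonneg_if_abs[OF n body(5,6,4) *] pos even by blast
      then show ?thesis using *[of x] by simp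
    qed
    then show ?thesis using body by (intro support_fun_inject) auto
  qed
  then have "(THE M. is_Lp_sum p K L M) = M" using M by (intro the_equality)
  then show ?thesis unfolding Lp_add_def using n by simp
qed

section \<open>The l_p norm and the body it supports\<close>

definition lp_norm :: "ereal \<Rightarrow> real ^ 'n \<Rightarrow> real" where
  "lp_norm p x = (if p = \<infinity> then Max (range (\<lambda>i. \<bar>x $ i\<bar>))
     else (\<Sum>i\<in>UNIV. \<bar>x $ i\<bar> powr real_of_ereal p) powr (1 / real_of_ereal p))"

lemma lp_norm_minus [simp]: "lp_norm p (- x) = lp_norm p x"
  by (simp add: lp_norm_def)

lemma component_le_lp_norm:
  assumes "p \<ge> 1" shows "\<bar>x $ i\<bar> \<le> lp_norm p x"
proof (cases "p = \<infinity>")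
  case True
  then show ?thesis by (simp add: lp_norm_def)
next
  case False
  then obtain q where q: "p = ereal q" "q \<ge> 1" using assms by (cases p) auto
  have "\<bar>x $ i\<bar> powr q \<le> (\<Sum>i\<in>UNIV. \<bar>x $ i\<bar> powr q)"
    by (rule member_le_sum) auto
  then have "(\<bar>x $ i\<bar> powr q) powr (1/q) \<le> (\<Sum>i\<in>UNIV. \<bar>x $ i\<bar> powr q) powr (1/q)"
    using q by (intro powr_mono2) auto
  then show ?thesis using q by (simp add: lp_norm_def powr_powr)
qed

lemma lp_norm_pos:
  assumes "p \<ge> 1" "x \<noteq> 0" shows "lp_norm p x > 0"
proof -
  obtain i where "x $ i \<noteq> 0" using assms(2) by (auto simp: vec_eq_iff)
  then show ?thesis using component_le_lp_norm[OF assms(1), of x i] by linarith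
qed

lemma lp_norm_0 [simp]: "lp_norm p (0 :: real ^ 'n) = 0"
  by (simp add: lp_norm_def)

lemma lp_norm_axis:
  assumes "p \<ge> 1" shows "lp_norm p (axis i c) = \<bar>c\<bar>"
proof (cases "p = \<infinity>")
  case True
  have "Max (range (\<lambda>j. \<bar>axis i c $ j\<bar>)) = \<bar>c\<bar>"
    by (rule Max_eqI) (auto simp: axis_def intro: image_eqI[of _ _ i])
  then show ?thesis using True by (simp add: lp_norm_def)
next
  case False
  then obtain q where q: "p = ereal q" "q \<ge> 1" using assms by (cases p) auto
  have "(\<Sum>j\<in>UNIV. \<bar>axis i c $ j\<bar> powr q) = (\<Sum>j\<in>UNIV. if j = i then \<bar>c\<bar> powr q else 0)"
    by (intro sum.cong) (auto simp: axis_def)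
  then show ?thesis using q by (simp add: lp_norm_def powr_powr)
qed

text \<open>For \<open>p < \<infinity>\<close>, the witness is the equality case of Hoelder's inequality.\<close>

lemma lp_norm_dual_attained:
  fixes x :: "real ^ 'n"
  assumes "p > 1"
  obtains y where "x \<bullet> y = lp_norm p x" "\<And>z. z \<bullet> y \<le> lp_norm p z"
proof -
  have p1: "p \<ge> 1" using assms by simp
  show thesis
  proof (cases "p = \<infinity>")
    case True
    have "Max (range (\<lambda>i. \<bar>x $ i\<bar>)) \<in> range (\<lambda>i. \<bar>x $ i\<bar>)" by (rule Max_in) auto
    then obtain i where "Max (range (\<lambda>i. \<bar>x $ i\<bar>)) = \<bar>x $ i\<bar>" by (rule imageE)
    then have i: "lp_norm p x = \<bar>x $ i\<bar>" using True by (simp add: lp_norm_def)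
    show thesis
    proof
      \<comment> \<open>The witness is the axis vector at a maximal coordinate, with the sign of
        that coordinate (zero if \<open>x = 0\<close>).\<close>
      show "x \<bullet> axis i (sgn (x $ i)) = lp_norm p x"
        by (simp add: i inner_axis sgn_if)
      fix z
      have "z \<bullet> axis i (sgn (x $ i)) \<le> \<bar>z $ i\<bar>" by (auto simp: inner_axis sgn_if)
      then show "z \<bullet> axis i (sgn (x $ i)) \<le> lp_norm p z"
        using component_le_lp_norm[of p z i] p1 by fastforce
    qed
  next
    case False
    then obtain q where q: "p = ereal q" "q > 1" using assms by (cases p) auto
    show thesis
    proof (cases "x = 0")
      case True
      have "0 \<le> lp_norm p z" for z :: "real ^ 'n"
        using lp_norm_pos[of p z] p1 by (cases "z = 0") auto
      then show thesis using True that[of 0] by simp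
    next
      case x: False
      define N where "N = lp_norm p x"
      have N: "N > 0" using lp_norm_pos[OF p1 x] by (simp add: N_def)
      have powrN: "(\<Sum>i\<in>UNIV. (\<bar>z $ i\<bar> / lp_norm p z) powr q) = 1" if "z \<noteq> 0" for z :: "real ^ 'n"
      proof -
        have pos: "lp_norm p z > 0" using lp_norm_pos[OF p1 that] .
        have "lp_norm p z powr q = (\<Sum>i\<in>UNIV. \<bar>z $ i\<bar> powr q)"
          using q by (simp add: lp_norm_def powr_powr sum_nonneg)
        moreover have "(\<Sum>i\<in>UNIV. (\<bar>z $ i\<bar> / lp_norm p z) powr q)
            = (\<Sum>i\<in>UNIV. \<bar>z $ i\<bar> powr q) / lp_norm p z powr q"
          using pos by (simp add: powr_divide sum_divide_distrib)
        moreover have "lp_norm p z powr q \<noteq> 0" using pos by simp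
        ultimately show ?thesis by simp
      qed
      \<comment> \<open>\<open>y\<close> is the gradient of the norm at \<open>x\<close>.\<close>
      define b where "b i = (\<bar>x $ i\<bar> / N) powr (q - 1)" for i
      define y :: "real ^ 'n" where "y = (\<chi> i. sgn (x $ i) * b i)"
      show thesis
      proof (rule that[of y])
        have "x $ i * y $ i = N * (\<bar>x $ i\<bar> / N) powr q" for i
        proof (cases "x $ i = 0")
          case False
          then have "(\<bar>x $ i\<bar> / N) powr q = (\<bar>x $ i\<bar> / N) powr (q - 1) * (\<bar>x $ i\<bar> / N)"
            using N by (simp add: powr_diff)
          then show ?thesis using N by (simp add: y_def b_def sgn_if)
        qed (use q in \<open>simp add: y_def\<close>)
        then have "x \<bullet> y = N * (\<Sum>i\<in>UNIV. (\<bar>x $ i\<bar> / N) powr q)"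
          by (simp add: inner_vec_def sum_distrib_left)
        then show "x \<bullet> y = lp_norm p x" using powrN[OF x] by (simp add: N_def)
      next
        fix z :: "real ^ 'n"
        show "z \<bullet> y \<le> lp_norm p z"
        proof (cases "z = 0")
          case z: False
          define A where "A = lp_norm p z"
          have A: "A > 0" using lp_norm_pos[OF p1 z] by (simp add: A_def)
          \<comment> \<open>The conjugate exponent: \<open>(q - 1) * q' = q\<close> turns
            \<open>b i powr q'\<close> into \<open>(\<bar>x $ i\<bar> / N) powr q\<close>.\<close>
          define q' where "q' = q / (q - 1)"
          have q': "q' > 1" "1 / q + 1 / q' = 1"
            using q by (auto simp: q'_def field_simps)
          \<comment> \<open>Young's inequality for coordinates scaled to norm one. After summation
            both power sums equal 1 and the weights 1/q and 1/q' add up to 1, leaving exactly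
            \<open>A\<close>.\<close>
          have "z $ i * y $ i \<le> A * ((\<bar>z $ i\<bar> / A) powr q / q + (\<bar>x $ i\<bar> / N) powr q / q')" for i
          proof -
            have "\<bar>y $ i\<bar> \<le> b i" by (auto simp: y_def b_def abs_mult sgn_if)
            then have "\<bar>z $ i\<bar> * \<bar>y $ i\<bar> \<le> \<bar>z $ i\<bar> * b i" by (intro mult_left_mono) auto
            then have "z $ i * y $ i \<le> \<bar>z $ i\<bar> * b i"
              by (metis abs_le_D1 abs_mult)
            also have "\<dots> = A * (\<bar>z $ i\<bar> / A * b i)" using A by simp
            also have "\<bar>z $ i\<bar> / A * b i \<le> (\<bar>z $ i\<bar> / A) powr q / q + b i powr q' / q'"
              using q q' A by (intro Youngs_inequality) (auto simp: b_def)
            also have "b i powr q' = (\<bar>x $ i\<bar> / N) powr q"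
              using q by (simp add: b_def powr_powr q'_def)
            finally show ?thesis using A by simp
          qed
          then have "z \<bullet> y \<le> (\<Sum>i\<in>UNIV. A * ((\<bar>z $ i\<bar> / A) powr q / q + (\<bar>x $ i\<bar> / N) powr q / q'))"
            unfolding inner_vec_def by (auto intro: sum_mono)
          also have "\<dots> = A * ((\<Sum>i\<in>UNIV. (\<bar>z $ i\<bar> / A) powr q) / q
              + (\<Sum>i\<in>UNIV. (\<bar>x $ i\<bar> / N) powr q) / q')"
            by (simp add: sum_distrib_left sum.distrib sum_divide_distrib distrib_left)
          also have "\<dots> = A" using powrN[OF z] powrN[OF x] q'(2) by (simp add: A_def N_def)
          finally show ?thesis by (simp add: A_def)
        qed simp
      qed
    qed
  qed
qed

text \<open>For p >= 1 this is the unit ball of the conjugate norm. As an intersection of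
  half-spaces it is closed and convex at once, with no conjugate exponent and no separate case p =
  infinity.\<close>

definition dual_ball :: "ereal \<Rightarrow> (real ^ 'n) set" where
  "dual_ball p = {y. \<forall>x. x \<bullet> y \<le> lp_norm p x}"

lemma compact_dual_ball:
  assumes "p \<ge> 1" shows "compact (dual_ball p :: (real ^ 'n) set)"
proof -
  have "dual_ball p = (\<Inter>x. {y :: real ^ 'n. x \<bullet> y \<le> lp_norm p x})"
    by (auto simp: dual_ball_def)
  then have "closed (dual_ball p :: (real ^ 'n) set)"
    by (auto intro!: closed_INT closed_halfspace_le)
  moreover have "dual_ball p \<subseteq> (cbox (vec (-1)) (vec 1) :: (real ^ 'n) set)"
  proof
    fix y :: "real ^ 'n" assume "y \<in> dual_ball p"
    \<comment> \<open>Testing against multiples of the axis vectors bounds every coordinate by 1 in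
      absolute value.\<close>
    then have "axis i c \<bullet> y \<le> lp_norm p (axis i c)" for i c
      by (simp add: dual_ball_def)
    then have "c * y $ i \<le> \<bar>c\<bar>" for i c
      using assms by (simp add: lp_norm_axis inner_axis')
    from this[of 1] this[of "-1"] show "y \<in> cbox (vec (-1)) (vec 1)"
      by (simp add: mem_box_cart minus_le_iff)
  qed
  ultimately show ?thesis
    using bounded_cbox bounded_subset compact_eq_bounded_closed by blast
qed

lemma dual_ball_in_sym_convex_bodies:
  assumes "p \<ge> 1" shows "(dual_ball p :: (real ^ 'n) set) \<in> sym_convex_bodies"
proof -
  have "0 \<le> lp_norm p x" for x :: "real ^ 'n"
    using lp_norm_pos[of p x] assms by (cases "x = 0") auto
  then have "(0 :: real ^ 'n) \<in> dual_ball p" by (simp add: dual_ball_def)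
  moreover have "dual_ball p = (\<Inter>x. {y :: real ^ 'n. x \<bullet> y \<le> lp_norm p x})"
    by (auto simp: dual_ball_def)
  then have "convex (dual_ball p :: (real ^ 'n) set)"
    by (auto intro!: convex_INT convex_halfspace_le)
  moreover have "- y \<in> dual_ball p" if "y \<in> dual_ball p" for y :: "real ^ 'n"
    unfolding dual_ball_def
  proof clarify
    fix x
    have "(- x) \<bullet> y \<le> lp_norm p (- x)" using that unfolding dual_ball_def by blast
    then show "x \<bullet> (- y) \<le> lp_norm p x" by simp
  qed
  then have "dual_ball p = uminus ` (dual_ball p :: (real ^ 'n) set)"
    by (metis (no_types, lifting) equation_minus_iff image_eqI subsetI image_subsetI subset_antisym)
  ultimately show ?thesis
    using compact_dual_ball[OF assms] by (auto simp: sym_convex_bodies_def)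
qed

text \<open>The upper bound is built into \<open>dual_ball\<close>; it is attained at the witness of
  \<open>lp_norm_dual_attained\<close>, which lies in \<open>dual_ball\<close>.\<close>

lemma support_fun_dual_ball:
  fixes x :: "real ^ 'n"
  assumes "p > 1" shows "support_fun (dual_ball p) x = lp_norm p x"
proof (rule antisym)
  have p: "p \<ge> 1" using assms by simp
  show "support_fun (dual_ball p) x \<le> lp_norm p x"
    using dual_ball_in_sym_convex_bodies[OF p, where 'n='n]
    by (intro support_fun_le) (auto simp: sym_convex_bodies_def dual_ball_def)
  obtain y where "x \<bullet> y = lp_norm p x" "\<And>z. z \<bullet> y \<le> lp_norm p z"
    using lp_norm_dual_attained[OF assms] by blast
  then show "lp_norm p x \<le> support_fun (dual_ball p) x"
    using inner_le_support_fun[OF compact_dual_ball[OF p], of y x] by (simp add: dual_ball_def)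
qed

lemma measure_dual_ball_pos:
  assumes "p \<ge> 1" shows "measure lebesgue (dual_ball p :: (real ^ 'n) set) > 0"
proof -
  \<comment> \<open>Half the side of a cube inside the body: each of the n products in
    \<open>x \<bullet> y\<close> is then at most a 1/n share of \<open>lp_norm p x\<close>.\<close>
  define d where "d = 1 / real CARD('n)"
  have d: "d > 0" by (simp add: d_def)
  have "cbox (vec (- d)) (vec d) \<subseteq> (dual_ball p :: (real ^ 'n) set)"
    unfolding dual_ball_def
  proof clarify
    fix y x :: "real ^ 'n" assume y: "y \<in> cbox (vec (- d)) (vec d)"
    have "x $ i * y $ i \<le> lp_norm p x * d" for i
    proof -
      have "\<bar>y $ i\<bar> \<le> d" using y by (simp add: mem_box_cart abs_le_iff minus_le_iff)
      then have "\<bar>x $ i\<bar> * \<bar>y $ i\<bar> \<le> lp_norm p x * d"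
        using component_le_lp_norm[OF assms, of x i] by (intro mult_mono) auto
      then show ?thesis by (metis abs_le_D1 abs_mult)
    qed
    then have "x \<bullet> y \<le> (\<Sum>i\<in>(UNIV :: 'n set). lp_norm p x * d)"
      unfolding inner_vec_def inner_real_def by (intro sum_mono)
    then show "x \<bullet> y \<le> lp_norm p x" by (simp add: d_def)
  qed
  moreover have "measure lebesgue (cbox (vec (- d)) (vec d) :: (real ^ 'n) set) > 0"
    using d by (simp add: content_cbox_if_cart interval_eq_empty_cart not_less)
  moreover have "(dual_ball p :: (real ^ 'n) set) \<in> lmeasurable"
    using compact_dual_ball[OF assms] by (rule lmeasurable_compact)
  ultimately show ?thesis
    by (smt (verit) measure_mono_fmeasurable fmeasurableD lmeasurable_cbox)
qed

section \<open>The L_p sum as a stretch along an axis\<close>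

definition axis_segment :: "'n \<Rightarrow> (real ^ 'n) set" where
  "axis_segment i = axis i ` {-1..1}"

lemma axis_segment_in_sym_convex_bodies: "axis_segment (i :: 'n::finite) \<in> sym_convex_bodies"
proof -
  have lin: "linear (axis i :: real \<Rightarrow> real ^ 'n)"
    by (intro linearI) (auto simp: axis_def vec_eq_iff)
  have "uminus ` axis_segment i = axis i ` uminus ` {-1..1 :: real}"
    unfolding axis_segment_def image_image by (simp add: linear_neg[OF lin])
  then show ?thesis
    unfolding sym_convex_bodies_def
    using lin by (auto simp: axis_segment_def compact_continuous_image linear_continuous_on
      linear_conv_bounded_linear[symmetric] intro!: convex_linear_image)
qed

lemma support_fun_axis_segment:
  fixes i :: "'n::finite"
  assumes "r \<ge> 0"
  shows "support_fun ((*\<^sub>R) r ` axis_segment i) x = r * \<bar>x $ i\<bar>"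
proof (rule antisym)
  have eq: "(*\<^sub>R) r ` axis_segment i = axis i ` (*) r ` {-1..1}"
    by (auto simp: axis_segment_def axis_def vec_eq_iff image_image intro!: image_cong)
  have in_le: "x \<bullet> axis i (r * c) \<le> r * \<bar>x $ i\<bar>" if "c \<in> {-1..1}" for c
  proof -
    have "x $ i * c \<le> \<bar>x $ i\<bar>"
      using that mult_left_le[of "\<bar>c\<bar>" "\<bar>x $ i\<bar>"] abs_le_D1[of "x $ i * c"] by (auto simp: abs_mult)
    then have "r * (x $ i * c) \<le> r * \<bar>x $ i\<bar>" using assms by (rule mult_left_mono)
    then show ?thesis by (simp add: inner_axis ac_simps)
  qed
  then show "support_fun ((*\<^sub>R) r ` axis_segment i) x \<le> r * \<bar>x $ i\<bar>"
    unfolding eq by (intro support_fun_le) auto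
  have "compact ((*\<^sub>R) r ` axis_segment i)"
    using axis_segment_in_sym_convex_bodies[of i]
    by (auto simp: sym_convex_bodies_def intro: compact_scaling)
  \<comment> \<open>The maximiser is the endpoint on the side given by the sign of
    \<open>x $ i\<close>, or the origin if \<open>x $ i = 0\<close>.\<close>
  then have "x \<bullet> axis i (r * sgn (x $ i)) \<le> support_fun ((*\<^sub>R) r ` axis_segment i) x"
    by (rule inner_le_support_fun) (force simp: eq sgn_if)
  then show "r * \<bar>x $ i\<bar> \<le> support_fun ((*\<^sub>R) r ` axis_segment i) x"
    by (simp add: inner_axis abs_sgn ac_simps)
qed

text \<open>A diagonal map with a single nontrivial entry, in the form to which
  \<open>measure_stretch\<close> applies.\<close>

abbreviation stretch_at :: "'n \<Rightarrow> real \<Rightarrow> real ^ 'n \<Rightarrow> real ^ 'n" where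
  "stretch_at i c x \<equiv> (\<chi> k. (if k = i then c else 1) * x $ k)"

text \<open>Replacing an entry of a maximum by the larger of itself and
  \<open>r * \<bar>x $ i\<bar>\<close> amounts to adding the latter as a further entry.\<close>

lemma lp_norm_stretch_infinity:
  fixes x :: "real ^ 'n"
  assumes "r \<ge> 0"
  shows "lp_norm \<infinity> (stretch_at i (max r 1) x) = max (r * \<bar>x $ i\<bar>) (lp_norm \<infinity> x)"
proof (rule antisym)
  have le: "\<bar>z $ k\<bar> \<le> lp_norm \<infinity> z" for z :: "real ^ 'n" and k
    by (simp add: component_le_lp_norm)
  have lub: "lp_norm \<infinity> z \<le> c" if "\<And>k. \<bar>z $ k\<bar> \<le> c" for z :: "real ^ 'n" and c
    using that by (simp add: lp_norm_def)
  show "lp_norm \<infinity> (stretch_at i (max r 1) x) \<le> max (r * \<bar>x $ i\<bar>) (lp_norm \<infinity> x)"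
  proof (rule lub)
    fix k
    show "\<bar>stretch_at i (max r 1) x $ k\<bar> \<le> max (r * \<bar>x $ i\<bar>) (lp_norm \<infinity> x)"
    \<comment> \<open>Outside this case the factor at \<open>k\<close> is 1.\<close>
    proof (cases "k = i \<and> r \<ge> 1")
      case False
      then have "stretch_at i (max r 1) x $ k = x $ k" by auto
      then show ?thesis using le[of x k] by (simp only: le_max_iff_disj simp_thms)
    qed (auto simp: abs_mult)
  qed
  have mono: "c * \<bar>x $ i\<bar> \<le> max r 1 * \<bar>x $ i\<bar>" if "c \<in> {r, 1}" for c
    using that by (intro mult_right_mono) auto
  have "r * \<bar>x $ i\<bar> \<le> lp_norm \<infinity> (stretch_at i (max r 1) x)"
    using le[of "stretch_at i (max r 1) x" i] mono[of r] assms by (auto simp: abs_mult)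
  moreover have "\<bar>x $ k\<bar> \<le> lp_norm \<infinity> (stretch_at i (max r 1) x)" for k
    using le[of "stretch_at i (max r 1) x" k] mono[of 1] assms
    by (cases "k = i") (auto simp: abs_mult)
  ultimately show "max (r * \<bar>x $ i\<bar>) (lp_norm \<infinity> x) \<le> lp_norm \<infinity> (stretch_at i (max r 1) x)"
    by (simp add: lub)
qed

text \<open>The q-th power of the factor is \<open>r powr q + 1\<close>, so the i-th summand of the
  power sum splits into the contribution of the segment and the original summand.\<close>

lemma lp_norm_stretch_finite:
  fixes x :: "real ^ 'n"
  assumes "r \<ge> 0" "q > 0"
  shows "lp_norm (ereal q) (stretch_at i ((r powr q + 1) powr (1 / q)) x) powr q
    = (r * \<bar>x $ i\<bar>) powr q + lp_norm (ereal q) x powr q"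
proof -
  have norm: "lp_norm (ereal q) z powr q = (\<Sum>k\<in>UNIV. \<bar>z $ k\<bar> powr q)" for z :: "real ^ 'n"
    using assms by (simp add: lp_norm_def powr_powr sum_nonneg)
  define c where "c = (r powr q + 1) powr (1 / q)"
  have c: "c \<ge> 0" "c powr q = r powr q + 1"
    using assms by (auto simp: c_def powr_powr)
  have "\<bar>stretch_at i c x $ k\<bar> powr q
      = (if k = i then (r * \<bar>x $ i\<bar>) powr q else 0) + \<bar>x $ k\<bar> powr q" for k
    using c assms by (auto simp: abs_mult powr_mult algebra_simps)
  then show ?thesis unfolding norm c_def[symmetric] by (simp add: sum.distrib)
qed

lemma Lp_radius_infinity: "Lp_radius \<infinity> s t = max s t"
  unfolding Lp_radius_def infinity_ereal_def by (simp only: ereal.case)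

text \<open>The diagonal map is self-adjoint, so the support function of the stretched body is the
  norm composed with the stretch; the two stretch identities are then precisely the defining
  relation of the sum.\<close>

lemma Lp_add_axis_segment_dual_ball:
  fixes i :: "'n::finite"
  assumes n: "CARD('n) \<ge> 2" and p: "p > 1" and r: "r \<ge> 0"
  shows "Lp_add p ((*\<^sub>R) r ` axis_segment i) (dual_ball p)
    = stretch_at i (Lp_radius p r 1) ` dual_ball p"
proof (rule Lp_add_eqI[OF n])
  have p1: "p \<ge> 1" using p by simp
  then show "1 \<le> p" .
  define c where "c = Lp_radius p r 1"
  have c: "c > 0"
    using p by (cases p) (auto simp: c_def Lp_radius_def add_nonneg_eq_0_iff)
  have lin: "linear (stretch_at i c :: real ^ 'n \<Rightarrow> real ^ 'n)"
    by (intro linearI) (auto simp: vec_eq_iff algebra_simps)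
  have adj: "x \<bullet> stretch_at i c y = stretch_at i c x \<bullet> y" for x y :: "real ^ 'n"
    by (auto simp: inner_vec_def intro!: sum.cong)
  have supp: "support_fun (stretch_at i c ` dual_ball p) x = lp_norm p (stretch_at i c x)"
    for x :: "real ^ 'n"
    using support_fun_dual_ball[OF p, of "stretch_at i c x"]
    by (simp add: support_fun_def image_image adj)
  show "support_fun (stretch_at i (Lp_radius p r 1) ` dual_ball p) x > 0" if "x \<noteq> 0" for x
  proof -
    have "stretch_at i c x \<noteq> 0" using that c by (auto simp: vec_eq_iff)
    then show ?thesis unfolding c_def[symmetric] supp using lp_norm_pos[OF p1] by blast
  qed
  have neg: "stretch_at i c (- x) = - stretch_at i c x" for x by (auto simp: vec_eq_iff)
  show "support_fun (stretch_at i (Lp_radius p r 1) ` dual_ball p) (- x)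
    = support_fun (stretch_at i (Lp_radius p r 1) ` dual_ball p) x" for x
    unfolding c_def[symmetric] supp neg by simp
  have "continuous_on S (stretch_at i c)" for S
    using lin by (simp add: linear_continuous_on linear_conv_bounded_linear)
  then have body: "stretch_at i c ` dual_ball p \<noteq> {}" "compact (stretch_at i c ` dual_ball p)"
    "convex (stretch_at i c ` dual_ball p)"
    using dual_ball_in_sym_convex_bodies[OF p1, where 'n='n] lin
    by (auto simp: sym_convex_bodies_def intro!: compact_continuous_image convex_linear_image)
  have "lp_norm \<infinity> (stretch_at i c x) = max (r * \<bar>x $ i\<bar>) (lp_norm \<infinity> x)" if "p = \<infinity>" for x
    unfolding c_def that Lp_radius_infinity by (rule lp_norm_stretch_infinity[OF r])
  moreover have "lp_norm p (stretch_at i c x) powr real_of_ereal p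
      = (r * \<bar>x $ i\<bar>) powr real_of_ereal p + lp_norm p x powr real_of_ereal p" if fin: "p \<noteq> \<infinity>" for x
  proof -
    obtain q where q: "p = ereal q" "q > 1" using fin p by (cases p) auto
    then have "c = (r powr q + 1) powr (1 / q)" by (simp add: c_def Lp_radius_def)
    then show ?thesis
      using lp_norm_stretch_finite[OF r, of q i x] q by (simp only: real_of_ereal.simps)
  qed
  ultimately show "is_Lp_sum p ((*\<^sub>R) r ` axis_segment i) (dual_ball p)
      (stretch_at i (Lp_radius p r 1) ` dual_ball p)"
    unfolding c_def[symmetric] is_Lp_sum_def supp support_fun_axis_segment[OF r]
      support_fun_dual_ball[OF p]
    using body by (cases "p = \<infinity>") simp_all
qed

lemma measure_stretch_dual_ball:
  fixes i :: "'n::finite"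
  assumes "p \<ge> 1" "c \<ge> 0"
  shows "measure lebesgue (stretch_at i c ` dual_ball p) = c * measure lebesgue (dual_ball p :: (real ^ 'n) set)"
proof -
  have "(dual_ball p :: (real ^ 'n) set) \<in> lmeasurable"
    using compact_dual_ball[OF assms(1)] by (rule lmeasurable_compact)
  then show ?thesis using measure_stretch[of "dual_ball p" "\<lambda>k. if k = i then c else 1"] assms(2)
    by (simp add: prod.delta)
qed

section \<open>Symmetric intervals in dimension one\<close>

lemma sym_interval_in_sym_convex_bodies:
  assumes "s \<ge> 0" shows "(sym_interval s :: (real ^ 'n) set) \<in> sym_convex_bodies"
proof -
  have "uminus ` cbox (vec (- s)) (vec s) = (cbox (vec (- s)) (vec s) :: (real ^ 'n) set)"
    by (auto simp: mem_box_cart image_iff minus_le_iff le_minus_iff intro: bexI[of _ "- _"])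
  then show ?thesis using assms
    by (auto simp: sym_convex_bodies_def sym_interval_def compact_cbox interval_eq_empty_cart not_less)
qed

lemma scaleR_sym_interval:
  assumes "r \<ge> 0" "s \<ge> 0"
  shows "(*\<^sub>R) r ` (sym_interval s :: (real ^ 'n) set) = sym_interval (r * s)"
proof -
  have ne: "(cbox (vec (- s)) (vec s) :: (real ^ 'n) set) \<noteq> {}"
    using assms by (simp add: interval_eq_empty_cart not_less)
  have "r *\<^sub>R (vec (-s) :: real ^ 'n) = vec (- (r * s))" "r *\<^sub>R (vec s :: real ^ 'n) = vec (r * s)"
    by (auto simp: vec_eq_iff)
  then show ?thesis
    using image_smult_cbox[of r "vec (- s) :: real ^ 'n" "vec s"] assms ne
    by (simp add: sym_interval_def)
qed

text \<open>The corner \<open>vec s\<close> recovers the radius, which makes the description in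
  \<open>Lp_add\<close> unique in dimension one.\<close>

lemma sym_interval_inject:
  assumes "s \<ge> 0" "t \<ge> 0" "(sym_interval s :: (real ^ 'n) set) = sym_interval t"
  shows "s = t"
proof -
  have "(vec s :: real ^ 'n) \<in> sym_interval s" "(vec t :: real ^ 'n) \<in> sym_interval t"
    using assms(1,2) by (auto simp: sym_interval_def mem_box_cart)
  then have "(vec s :: real ^ 'n) \<in> sym_interval t" "(vec t :: real ^ 'n) \<in> sym_interval s"
    using assms(3) by auto
  then show ?thesis by (auto simp: sym_interval_def mem_box_cart intro: antisym)
qed

lemma Lp_add_sym_interval:
  assumes "CARD('n::finite) = 1" "s \<ge> 0" "t \<ge> 0"
  shows "Lp_add p (sym_interval s) (sym_interval t) = (sym_interval (Lp_radius p s t) :: (real ^ 'n) set)"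
  unfolding Lp_add_def using assms
  by (auto intro!: the_equality dest: sym_interval_inject)

lemma measure_sym_interval:
  assumes "CARD('n::finite) = 1" "s \<ge> 0"
  shows "measure lebesgue (sym_interval s :: (real ^ 'n) set) = 2 * s"
  using assms by (simp add: sym_interval_def content_cbox_if_cart interval_eq_empty_cart not_less)

section \<open>The radius function and its inversion law\<close>

lemma Lp_radius_nonneg: "s \<ge> 0 \<Longrightarrow> t \<ge> 0 \<Longrightarrow> Lp_radius p s t \<ge> 0"
  by (cases p) (auto simp: Lp_radius_def)

text \<open>Homogeneity and symmetry combined: taking \<open>r\<close> out of f(r, 1) leaves f(1,
  1/r) = f(1/r, 1).\<close>

lemma Lp_radius_inversion:
  assumes "p \<noteq> 0" "r > 0" shows "Lp_radius p r 1 = r * Lp_radius p (1 / r) 1"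
proof (cases p)
  case (real q)
  then have q: "q \<noteq> 0" using assms by auto
  have "r powr q + 1 = r powr q * ((1 / r) powr q + 1)"
    using assms by (simp add: powr_divide distrib_left)
  then have "(r powr q + 1) powr (1 / q) = (r powr q) powr (1/q) * ((1 / r) powr q + 1) powr (1 / q)"
    by (simp add: powr_mult)
  also have "(r powr q) powr (1 / q) = r" using q assms by (simp add: powr_powr)
  finally show ?thesis using real assms by (simp add: Lp_radius_def)
qed (use assms in \<open>auto simp: Lp_radius_def max_def min_def field_simps\<close>)

text \<open>f(0, 1) is 1 for positive and 0 for negative exponents, while f(1, 1) is 2^(1/q), or 1
  for infinite exponents; 2^(1/q) is never 0 and equals 2 only at q = 1.\<close>

lemma Lp_radius_1_1:
  assumes "p \<noteq> 0" "p \<noteq> 1" shows "Lp_radius p 1 1 \<noteq> 2 * Lp_radius p 0 1"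
proof (cases p)
  case (real q)
  then have q: "q \<noteq> 0" "q \<noteq> 1" using assms by auto
  have "2 powr (1 / q) \<noteq> (2 :: real)"
    using q powr_inj[of 2 "1 / q" 1] by auto
  then show ?thesis using q real by (auto simp: Lp_radius_def)
qed (auto simp: Lp_radius_def)

text \<open>Comparing \<open>r ^ m * f r\<close> with \<open>r * (r ^ m * f (1 / r))\<close>, a polynomial of degree at most
  \<open>m + 1\<close>, shows that \<open>f\<close> is affine.\<close>

lemma polynomial_inversion:
  fixes f :: "real \<Rightarrow> real"
  assumes poly: "\<And>r. r \<ge> 0 \<Longrightarrow> f r = (\<Sum>i\<le>m. c i * r ^ i)"
    and inv: "\<And>r. r > 0 \<Longrightarrow> f r = r * f (1 / r)"
  shows "f 1 = 2 * f 0"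
proof -
  define P where "P = (\<Sum>i\<le>m. monom (c i) i)"
  \<comment> \<open>The reversed polynomial, which takes the value \<open>r ^ m * f (1 / r)\<close>
    at positive \<open>r\<close>.\<close>
  define Q where "Q = (\<Sum>i\<le>m. monom (c i) (m - i))"
  have P: "f r = poly P r" if "r \<ge> 0" for r
    using poly[OF that] by (simp add: P_def poly_sum poly_monom)
  have Q: "poly Q r = r ^ m * f (1 / r)" if "r > 0" for r
    using poly[of "1 / r"] that
    by (auto simp: Q_def poly_sum poly_monom sum_distrib_left power_diff power_divide intro!: sum.cong)
  have "poly (monom 1 m * P - pCons 0 Q) r = 0" if "r > 0" for r
    using that P[of r] Q[OF that] inv[OF that] by (simp add: poly_monom)
  then have "{0<..} \<subseteq> {r. poly (monom 1 m * P - pCons 0 Q) r = 0}" by auto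
  then have "infinite {r. poly (monom 1 m * P - pCons 0 Q) r = 0}"
    using infinite_Ioi finite_subset by blast
  then have "monom 1 m * P - pCons 0 Q = 0"
    using poly_roots_finite by blast
  then have eq: "monom 1 m * P = pCons 0 Q" by (simp only: right_minus_eq)
  have "coeff Q k = 0" if "k > m" for k
    using that by (auto simp: Q_def coeff_sum intro!: sum.neutral)
  \<comment> \<open>In degree \<open>m + k\<close> the left side has \<open>coeff P k\<close> and
    the right side \<open>coeff Q (m + k - 1)\<close>, whose index exceeds \<open>m\<close> exactly
    when \<open>k > 1\<close>.\<close>
  then have Pk: "coeff P k = 0" if "k > 1" for k
    using arg_cong[OF eq, of "\<lambda>p. coeff p (m + k)"] that
    by (simp add: coeff_monom_mult coeff_pCons split: nat.split)
  define a b where "a = coeff P 0" and "b = coeff P 1"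
  have "P = [:a, b:]"
    by (rule poly_eqI) (auto simp: a_def b_def Pk coeff_pCons split: nat.split)
  then have f: "f r = a + b * r" if "r \<ge> 0" for r using P[OF that] by simp
  \<comment> \<open>At 2 the inversion law reads a + 2b = 2a + b, so a = b.\<close>
  show ?thesis using inv[of 2] f[of 2] f[of "1/2"] f[of 1] f[of 0] by simp
qed

section \<open>From volumes of sums to the contradiction\<close>

text \<open>Fixing \<open>s = 1\<close> leaves a polynomial in \<open>r\<close>; dividing by the
  constant \<open>v\<close> makes the radius itself polynomial, which its inversion law and its
  values at 0 and 1 forbid.\<close>

lemma not_polynomial_volume_if:
  fixes oper :: "(real ^ 'n) set \<Rightarrow> (real ^ 'n) set \<Rightarrow> (real ^ 'n) set"
  assumes "K \<in> sym_convex_bodies" "L \<in> sym_convex_bodies" "p \<noteq> 0" "p \<noteq> 1" "v > 0"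
    and vol: "\<And>r. r \<ge> 0 \<Longrightarrow> measure lebesgue (oper ((*\<^sub>R) r ` K) L) = Lp_radius p r 1 * v"
  shows "\<not> has_polynomial_volume oper"
proof
  assume "has_polynomial_volume oper"
  then obtain m a where ma: "\<forall>r\<ge>0. \<forall>s\<ge>0. measure lebesgue (oper ((*\<^sub>R) r ` K) ((*\<^sub>R) s ` L)) =
      (\<Sum>i\<le>m. \<Sum>j\<le>m. a i j * r ^ i * s ^ j)"
    using assms(1,2) unfolding has_polynomial_volume_def by meson
  have "Lp_radius p r 1 = (\<Sum>i\<le>m. (\<Sum>j\<le>m. a i j / v) * r ^ i)" if "r \<ge> 0" for r
  proof -
    have "Lp_radius p r 1 * v = (\<Sum>i\<le>m. \<Sum>j\<le>m. a i j * r ^ i)"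
      using ma[rule_format, OF that, of 1] vol[OF that] by simp
    then have "Lp_radius p r 1 = (\<Sum>i\<le>m. \<Sum>j\<le>m. a i j * r ^ i) / v"
      using assms(5) by (simp add: field_simps)
    then show ?thesis by (simp add: sum_divide_distrib sum_distrib_right)
  qed
  from polynomial_inversion[where f = "\<lambda>r. Lp_radius p r 1", OF this Lp_radius_inversion[OF assms(3)]]
  show False using Lp_radius_1_1[OF assms(3,4)] by simp
qed

theorem theorem10p3:
  fixes p :: ereal
  assumes "CARD('n::finite) = 1 \<Longrightarrow> p \<noteq> 0"
    and "CARD('n) \<ge> 2 \<Longrightarrow> 1 \<le> p"
    and "p \<noteq> 1"
  shows "\<not> has_polynomial_volume
           (Lp_add p :: (real ^ 'n) set \<Rightarrow> (real ^ 'n) set \<Rightarrow> (real ^ 'n) set)"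
proof (cases "CARD('n) = 1")
  case True
  have "measure lebesgue (Lp_add p ((*\<^sub>R) r ` sym_interval 1) (sym_interval 1 :: (real ^ 'n) set))
      = Lp_radius p r 1 * 2" if "r \<ge> 0" for r
    using that True
    by (simp add: scaleR_sym_interval Lp_add_sym_interval measure_sym_interval Lp_radius_nonneg)
  then show ?thesis
    using True assms
    by (intro not_polynomial_volume_if[where K="sym_interval 1" and L="sym_interval 1" and v=2 and p=p]
        sym_interval_in_sym_convex_bodies) auto
next
  case False
  moreover have "CARD('n) > 0" by simp
  ultimately have n: "CARD('n) \<ge> 2" by linarith
  then have p: "p > 1" "p \<ge> 1" using assms by auto
  \<comment> \<open>Any coordinate direction will do.\<close>
  obtain i :: 'n where True by blast
  have "measure lebesgue (Lp_add p ((*\<^sub>R) r ` axis_segment i) (dual_ball p))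
      = Lp_radius p r 1 * measure lebesgue (dual_ball p :: (real ^ 'n) set)" if "r \<ge> 0" for r
    using that p n
    by (simp add: Lp_add_axis_segment_dual_ball measure_stretch_dual_ball Lp_radius_nonneg)
  then show ?thesis
    using p assms(3)
    by (intro not_polynomial_volume_if[where K="axis_segment i" and L="dual_ball p" and p=p,
          OF axis_segment_in_sym_convex_bodies dual_ball_in_sym_convex_bodies])
      (auto simp: measure_dual_ball_pos)
qed

end
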